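(* Let $\ell\ge 1$ and $0\le m\le n$ be integers. For any integer $k$ such that $0\le k\le m$, the entry $g_{\ell,n}^m$ equals the number of permutations $\pi\in G_{\ell,n}$ whose $k$-circular successions are included in $[m]$, i.e. such that $\mathcal{C}^k(\pi)\subseteq[m]$. In particular, by taking $k=0$ and $k=m$ respectively: (i) the entry $g_{\ell,n}^m$ is the number of permutations in $G_{\ell,n}$ whose fixed points are included in $[m]$; (ii) the entry $g_{\ell,n}^m$ is the number of permutations in $G_{\ell,n}$ without $m$-circular succession.
   Context: Write $[n]=\{1,\dots,n\}$ (with $[0]=\emptyset$). For a fixed integer $\ell\ge1$, let $C_\ell$ be the cyclic group generated by $\zeta=e^{2i\pi/\ell}$. The group $G_{\ell,n}=C_\ell\wr S_n$ of colored permutations consists of the pairs $\pi=(\epsilon,\sigma)$ with $\epsilon=(\epsilon_1,\dots,\epsilon_n)\in C_\ell^n$ and $\sigma\in S_n$; $\pi$ is identified with the permutation of the colored set $\{\zeta^j i : i\in[n],\ 0\le j\le \ell-1\}$ (regarded as $C_\ell\times[n]$) given by $\pi(i)=\epsilon_{\sigma(i)}\sigma(i)$ and $\pi(\zeta^j i)=\zeta^j\pi(i)$ for $i\in[n]$. Thus $|G_{\ell,n}|=\ell^n n!$. A letter is uncolored if its color is $1$. For an integer $k\ge0$ and $\pi\in G_{\ell,n}$, the value $\pi(i)$ is a $k$-circular succession of $\pi$ at position $i\in[n]$ if $\pi(i)=i+k$, where $i+k$ must be an uncolored element of $[n]$ (no wraparound modulo $n$). A $0$-circular succession is called a fixed point.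 $\mathcal{C}^k(\pi)$ denotes the set of $k$-circular successions (values) of $\pi$. Euler's difference table $(g_{\ell,n}^m)_{0\le m\le n}$ is defined by $g_{\ell,n}^n=\ell^n n!$ and $g_{\ell,n}^m=g_{\ell,n}^{m+1}-g_{\ell,n-1}^m$ for $0\le m\le n-1$. *)

theory Defs
  imports "HOL-Analysis.Complex_Transcendental" "HOL-Combinatorics.Permutations" "HOL-Library.FuncSet"
begin

definition zeta :: "nat \<Rightarrow> complex" where
  "zeta l = exp (2 * \<i> * of_real pi / of_nat l)"

definition colors :: "nat \<Rightarrow> complex set" where
  "colors l = (\<lambda>j. zeta l ^ j) ` {..<l}"

text \<open>
  A letter of color \<open>z\<close> and absolute value \<open>i\<close> is the pair \<open>(z, i)\<close>; the plain integer \<open>i\<close>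
  of the mathematical text is the uncolored letter \<open>(1, i)\<close>.
\<close>

type_synonym letter = "complex \<times> nat"
type_synonym cperm = "(nat \<Rightarrow> complex) \<times> (nat \<Rightarrow> nat)"

definition uncolored :: "nat \<Rightarrow> letter" where
  "uncolored i = (1, i)"

text \<open>
  The underlying set of the wreath product of the cyclic group of order \<open>l\<close> by the symmetric
  group on \<open>{1..n}\<close>. Both components are normalized outside \<open>{1..n}\<close> (\<open>undefined\<close>, respectively
  the identity), so that each colored permutation is represented exactly once.
\<close>

definition cperms :: "nat \<Rightarrow> nat \<Rightarrow> cperm set" where
  "cperms l n = ({1..n} \<rightarrow>\<^sub>E colors l) \<times> {\<sigma>. \<sigma> permutes {1..n}}"

text \<open>
  The permutation of the colored letters identified with \<open>(\<epsilon>, \<sigma>)\<close>. The color of the image is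
  indexed by the value \<open>\<sigma> i\<close>, not by the position \<open>i\<close>.
\<close>

fun act :: "cperm \<Rightarrow> letter \<Rightarrow> letter" where
  "act (\<epsilon>, \<sigma>) (z, i) = (z * \<epsilon> (\<sigma> i), \<sigma> i)"

definition circ_succs :: "nat \<Rightarrow> nat \<Rightarrow> cperm \<Rightarrow> letter set" where
  "circ_succs n k \<pi> = {act \<pi> (uncolored i) | i.
     i \<in> {1..n} \<and> i + k \<in> {1..n} \<and> act \<pi> (uncolored i) = uncolored (i + k)}"

definition fixed_points :: "nat \<Rightarrow> cperm \<Rightarrow> letter set" where
  "fixed_points n \<pi> = circ_succs n 0 \<pi>"

text \<open>
  \<open>euler_table l n m\<close> is the entry with lower index \<open>n\<close> and upper index \<open>m\<close>. Entries with
  \<open>m > n\<close> do not belong to the table; they get the dummy value 0 and are never used by the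
  recursion for \<open>m \<le> n\<close>.
\<close>

function euler_table :: "nat \<Rightarrow> nat \<Rightarrow> nat \<Rightarrow> int" where
  "m < n \<Longrightarrow> euler_table l n m = euler_table l n (m + 1) - euler_table l (n - 1) m"
| "euler_table l n n = int (l ^ n * fact n)"
| "n < m \<Longrightarrow> euler_table l n m = 0"
  by (metis linorder_neqE_nat prod_cases3) auto
termination
  by (relation "measure (\<lambda>(l, n, m). n - m)") auto

end

theory Submission imports Defs begin

text \<open>
  Inclusion in \<open>[m]\<close> says that the positions \<open>m - k + 1, \<dots>, n - k\<close>, of which there are \<open>n - m\<close>
  for every \<open>k \<le> m\<close>, each avoid one prescribed letter, and these letters have distinct absolute
  values. The number of colored permutations avoiding such a family of letters depends only
  on how many positions are constrained, and it is a table entry. Dropping the constraint at one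
  position \<open>a\<close> adds exactly the permutations that do take the forbidden letter at \<open>a\<close>; forgetting
  the position \<open>a\<close> and the value taken there leaves an arbitrary colored permutation of size one
  less that avoids the remaining letters. This is the recursion of the table, and with no
  constraint left the count is \<open>l ^ n * fact n\<close> (lemma \<open>card_avoiding_words\<close>).

  Forgetting a position and a value destroys the interval shape of \<open>{1..n}\<close>. Relabelling is avoided
  by counting colored bijections between arbitrary finite sets \<open>A\<close> and \<open>B\<close>, written
  as words \<open>w\<close> whose letter \<open>w i\<close> consists of the color and the absolute value of the image of \<open>i\<close>.
\<close>

section \<open>Colored words avoiding prescribed letters\<close>

definition colored_words :: "'c set \<Rightarrow> 'a set \<Rightarrow> 'b set \<Rightarrow> ('a \<Rightarrow> 'c \<times> 'b) set" where
  "colored_words C A B = {w \<in> A \<rightarrow>\<^sub>E C \<times> B. bij_betw (snd \<circ> w) A B}"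

definition avoiding_words ::
    "'c set \<Rightarrow> 'a set \<Rightarrow> 'b set \<Rightarrow> 'a set \<Rightarrow> ('a \<Rightarrow> 'c \<times> 'b) \<Rightarrow> ('a \<Rightarrow> 'c \<times> 'b) set" where
  "avoiding_words C A B Q q = {w \<in> colored_words C A B. \<forall>i\<in>Q. w i \<noteq> q i}"

lemma finite_colored_words:
  assumes "finite A" "finite B" "finite C"
  shows "finite (colored_words C A B)"
proof (rule finite_subset)
  show "colored_words C A B \<subseteq> A \<rightarrow>\<^sub>E C \<times> B"
    by (auto simp: colored_words_def)
  show "finite (A \<rightarrow>\<^sub>E C \<times> B)"
    using assms by (intro finite_PiE) auto
qed

lemma finite_avoiding_words:
  assumes "finite A" "finite B" "finite C"
  shows "finite (avoiding_words C A B Q q)"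
  using finite_colored_words[OF assms] by (simp add: avoiding_words_def)

text \<open>
  Restriction to \<open>A\<close> is inverted by putting the letter \<open>(c, b)\<close> back at \<open>a\<close>. As \<open>a\<close> is not one of
  the constrained positions, neither map affects avoidance.
\<close>

lemma card_avoiding_words_fixed_letter:
  assumes a: "a \<notin> A" and b: "b \<notin> B" and c: "c \<in> C" and Q: "Q \<subseteq> A"
  shows "card {w \<in> avoiding_words C (insert a A) (insert b B) Q q. w a = (c, b)} =
    card (avoiding_words C A B Q q)" (is "card ?S = card ?T")
proof (rule bij_betw_same_card[of "\<lambda>w. restrict w A"])
  have restr: "restrict w A \<in> ?T" if w: "w \<in> ?S" for w
  proof -
    have wP: "w \<in> insert a A \<rightarrow>\<^sub>E C \<times> insert b B" and wa: "w a = (c, b)"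
      and bij: "bij_betw (snd \<circ> w) (insert a A) (insert b B)" and av: "\<forall>i\<in>Q. w i \<noteq> q i"
      using w by (auto simp: avoiding_words_def colored_words_def)
    have bij': "bij_betw (snd \<circ> w) A B"
      using bij_betw_DiffI[OF bij, of "{a}" "{b}"] a b wa by (simp add: bij_betw_def)
    have "restrict w A \<in> A \<rightarrow>\<^sub>E C \<times> B"
    proof
      fix x assume x: "x \<in> A"
      have "snd (w x) \<in> B" using bij_betwE[OF bij'] x by auto
      moreover have "fst (w x) \<in> C" using PiE_mem[OF wP, of x] x by auto
      ultimately show "restrict w A x \<in> C \<times> B" using x by (simp add: mem_Times_iff)
    qed auto
    moreover have "bij_betw (snd \<circ> restrict w A) A B"
      using bij' by (subst bij_betw_cong[where g = "snd \<circ> w"]) auto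
    ultimately show ?thesis
      using av Q by (auto simp: avoiding_words_def colored_words_def)
  qed
  have ext: "w(a := (c, b)) \<in> ?S" if w: "w \<in> ?T" for w
  proof -
    have wP: "w \<in> A \<rightarrow>\<^sub>E C \<times> B" and bij: "bij_betw (snd \<circ> w) A B" and av: "\<forall>i\<in>Q. w i \<noteq> q i"
      using w by (auto simp: avoiding_words_def colored_words_def)
    have "w(a := (c, b)) \<in> insert a A \<rightarrow>\<^sub>E C \<times> insert b B"
      using c by (intro fun_upd_in_PiE PiE_I) (use wP a in \<open>auto simp: PiE_iff extensional_def\<close>)
    moreover have "bij_betw (snd \<circ> w(a := (c, b))) A B"
      using bij a by (subst bij_betw_cong[where g = "snd \<circ> w"]) auto
    then have "bij_betw (snd \<circ> w(a := (c, b))) (insert a A) (insert b B)"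
      using notIn_Un_bij_betw[of a A "snd \<circ> w(a := (c, b))" B] a b by simp
    ultimately show ?thesis
      using av Q a by (auto simp: avoiding_words_def colored_words_def)
  qed
  show "bij_betw (\<lambda>w. restrict w A) ?S ?T"
  proof (rule bij_betw_byWitness[where f' = "\<lambda>w. w(a := (c, b))"])
    show "\<forall>w\<in>?S. (restrict w A)(a := (c, b)) = w"
      by (auto simp: avoiding_words_def colored_words_def PiE_iff extensional_def fun_eq_iff)
    show "\<forall>w\<in>?T. restrict (w(a := (c, b))) A = w"
      using a by (auto simp: avoiding_words_def colored_words_def PiE_iff extensional_def fun_eq_iff
        restrict_def)
  qed (use restr ext in blast)+
qed

text \<open>
  The words are split according to their letter at a fixed position: each of the
  \<open>card C * card B\<close> letters leaves the same count for the rest.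
\<close>

lemma card_colored_words:
  fixes A :: "'a set" and B :: "'b set" and C :: "'c set"
  assumes "finite A" "finite B" "finite C" "card A = card B"
  shows "card (colored_words C A B) = card C ^ card A * fact (card A)"
  using assms(1,2,4)
proof (induction A arbitrary: B rule: finite_induct)
  case empty
  then have "colored_words C ({} :: 'a set) B = {\<lambda>_. undefined}"
    by (auto simp: colored_words_def bij_betw_def)
  then show ?case by simp
next
  case (insert a A)
  let ?W = "colored_words C (insert a A) B"
  let ?F = "\<lambda>x. {w \<in> ?W. w a = x}"
  have fib: "card (?F x) = card C ^ card A * fact (card A)" if x: "x \<in> C \<times> B" for x
  proof -
    obtain c b where cb: "x = (c, b)" "c \<in> C" "b \<in> B" using x by auto
    then have B: "insert b (B - {b}) = B" by auto
    have "card (?F x) = card (colored_words C A (B - {b}))"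
      using card_avoiding_words_fixed_letter[OF insert.hyps(2), of b "B - {b}" c C "{}" undefined]
        cb B by (simp add: avoiding_words_def)
    also have "\<dots> = card C ^ card A * fact (card A)"
      using insert.prems insert.hyps cb(3) by (intro insert.IH) auto
    finally show ?thesis .
  qed
  have "?W = (\<Union>x\<in>C \<times> B. ?F x)"
    by (auto simp: colored_words_def dest: PiE_mem)
  also have "card \<dots> = (\<Sum>x\<in>C \<times> B. card (?F x))"
    using insert.prems insert.hyps assms(3)
    by (intro card_UN_disjoint) (auto simp: finite_colored_words)
  also have "\<dots> = (card C * card B) * (card C ^ card A * fact (card A))"
    using fib by (simp add: card_cartesian_product)
  also have "\<dots> = card C ^ card (insert a A) * fact (card (insert a A))"
    using insert.prems(2)[symmetric] insert.hyps by (simp add: algebra_simps)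
  finally show ?case .
qed

text \<open>
  Imposing a further constraint at \<open>a\<close> removes the words that take the letter \<open>q a\<close> there, and by
  \<open>card_avoiding_words_fixed_letter\<close> these are counted by the problem of size \<open>n - 1\<close>. The absolute
  values of the letters \<open>q i\<close> are distinct because, once \<open>q a\<close> is taken at \<open>a\<close>, the letters forbidden
  elsewhere must still use only the remaining values: otherwise some of them would be avoided
  automatically, and the smaller problem would have fewer effective constraints.
\<close>

lemma card_avoiding_words:
  assumes "finite Q" "finite C" "finite A" "finite B" "card A = n" "card B = n"
    and "Q \<subseteq> A" "q ` Q \<subseteq> C \<times> B" "inj_on (snd \<circ> q) Q"
  shows "int (card (avoiding_words C A B Q q)) = euler_table (card C) n (n - card Q)"
  using assms
proof (induction Q arbitrary: A B n rule: finite_induct)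
  case empty
  then show ?case by (simp add: avoiding_words_def card_colored_words)
next
  case (insert a Q)
  define b where "b = snd (q a)"
  define c where "c = fst (q a)"
  define A' where "A' = A - {a}"
  define B' where "B' = B - {b}"
  have qa: "q a = (c, b)" by (simp add: b_def c_def)
  have A: "A = insert a A'" "a \<notin> A'" "finite A'" and B: "B = insert b B'" "b \<notin> B'" "finite B'"
    and c: "c \<in> C"
    using insert.prems qa by (auto simp: A'_def B'_def)
  obtain n' where n: "n = Suc n'" "card A' = n'" "card B' = n'"
    using insert.prems A B by auto
  have QA': "Q \<subseteq> A'"
    using insert.prems insert.hyps by (auto simp: A'_def)
  then have le: "card Q \<le> n'"
    using card_mono[OF A(3)] n by simp
  have "snd (q i) \<noteq> b" if "i \<in> Q" for i
    using that insert.prems(8) insert.hyps(2) by (auto simp: b_def inj_on_def)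
  then have QB': "q ` Q \<subseteq> C \<times> B'"
    using insert.prems(7) by (force simp: B'_def)
  have inj: "inj_on (snd \<circ> q) Q"
    using insert.prems(8) by (rule inj_on_subset) auto
  let ?X = "avoiding_words C A B Q q"
  let ?hit = "{w \<in> ?X. w a = q a}"
  have fin: "finite ?X"
    using insert.prems by (intro finite_avoiding_words)
  have "avoiding_words C A B (insert a Q) q = ?X - ?hit"
    by (auto simp: avoiding_words_def)
  then have "int (card (avoiding_words C A B (insert a Q) q)) = int (card ?X) - int (card ?hit)"
    using fin by (simp add: card_Diff_subset card_mono of_nat_diff)
  also have "card ?hit = card (avoiding_words C A' B' Q q)"
    using card_avoiding_words_fixed_letter[OF A(2) B(2) c QA'] A(1) B(1) qa by simp
  also have "int \<dots> = euler_table (card C) n' (n' - card Q)"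
    using insert.prems(1) A(3) B(3) n QA' QB' inj by (intro insert.IH)
  also have "int (card ?X) = euler_table (card C) n (n - card Q)"
    using insert.prems inj by (intro insert.IH) blast+
  also have "euler_table (card C) n (n - card Q) - euler_table (card C) n' (n' - card Q) =
      euler_table (card C) n (n - card (insert a Q))"
    using le n(1) insert.hyps by (simp add: Suc_diff_le)
  finally show ?case .
qed

section \<open>Colored permutations as words\<close>

definition word_of :: "nat \<Rightarrow> cperm \<Rightarrow> nat \<Rightarrow> letter" where
  "word_of n \<pi> = (\<lambda>i\<in>{1..n}. act \<pi> (uncolored i))"

lemma finite_colors: "finite (colors l)"
  by (simp add: colors_def)

lemma one_in_colors: "1 \<le> l \<Longrightarrow> 1 \<in> colors l"
  by (auto simp: colors_def intro!: image_eqI[where x = 0])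

lemma card_colors:
  assumes "1 \<le> l"
  shows "card (colors l) = l"
proof -
  have "inj_on (\<lambda>j. zeta l ^ j) {..<l}"
  proof (rule inj_onI)
    fix i j assume ij: "i \<in> {..<l}" "j \<in> {..<l}" and eq: "zeta l ^ i = zeta l ^ j"
    have "zeta l ^ k = exp (2 * of_real pi * \<i> * of_nat k / of_nat l)" for k
      by (simp add: zeta_def exp_of_nat_mult[symmetric] mult_ac)
    then have "i mod l = j mod l"
      using eq assms complex_root_unity_eq[of l i j] by simp
    then show "i = j" using ij by simp
  qed
  then show ?thesis by (simp add: colors_def card_image)
qed

lemma card_cperms:
  assumes "1 \<le> l"
  shows "card (cperms l n) = l ^ n * fact n"
  using assms
  by (simp add: cperms_def card_cartesian_product card_PiE card_permutations card_colors)

text \<open>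
  Recovering \<open>\<epsilon>\<close> from a word would require inverting \<open>\<sigma>\<close>, because colors are indexed by values.
  Surjectivity instead follows from injectivity, as both sides have \<open>l ^ n * fact n\<close> elements.
\<close>

lemma bij_betw_word_of:
  assumes "1 \<le> l"
  shows "bij_betw (word_of n) (cperms l n) (colored_words (colors l) {1..n} {1..n})"
    (is "bij_betw _ ?P ?W")
proof -
  have "inj_on (word_of n) ?P"
  proof (rule inj_onI)
    fix \<pi> \<pi>' assume \<pi>: "\<pi> \<in> ?P" "\<pi>' \<in> ?P" and eq: "word_of n \<pi> = word_of n \<pi>'"
    obtain e s e' s' where es: "\<pi> = (e, s)" "\<pi>' = (e', s')" by (metis surj_pair)
    have s: "s permutes {1..n}" "s' permutes {1..n}"
      and e: "e \<in> {1..n} \<rightarrow>\<^sub>E colors l" "e' \<in> {1..n} \<rightarrow>\<^sub>E colors l"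
      using \<pi> es by (auto simp: cperms_def)
    have same: "s i = s' i \<and> e (s i) = e' (s' i)" if "i \<in> {1..n}" for i
    proof -
      have "(e (s i), s i) = (e' (s' i), s' i)"
        using fun_cong[OF eq, of i] that es by (simp add: word_of_def uncolored_def del: prod.inject)
      then show ?thesis by blast
    qed
    have ss: "s = s'"
    proof
      fix i show "s i = s' i"
        using same s by (cases "i \<in> {1..n}") (auto simp: permutes_not_in)
    qed
    have "e = e'"
    proof (rule PiE_ext[OF e])
      fix j assume "j \<in> {1..n}"
      then obtain i where "i \<in> {1..n}" "j = s i"
        using permutes_image[OF s(1)] by blast
      then show "e j = e' j" using same[of i] ss by metis
    qed
    then show "\<pi> = \<pi>'" using ss es by simp
  qed
  moreover have "word_of n ` ?P \<subseteq> ?W"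
  proof
    fix w assume "w \<in> word_of n ` ?P"
    then obtain e s where w: "w = word_of n (e, s)" and s: "s permutes {1..n}"
      and e: "e \<in> {1..n} \<rightarrow>\<^sub>E colors l"
      by (auto simp: cperms_def)
    have wi: "w i = (e (s i), s i)" if "i \<in> {1..n}" for i
      using that by (simp add: w word_of_def uncolored_def)
    have "bij_betw (snd \<circ> w) {1..n} {1..n}"
      using permutes_imp_bij[OF s] wi by (subst bij_betw_cong[where g = s]) auto
    moreover have "w \<in> {1..n} \<rightarrow>\<^sub>E colors l \<times> {1..n}"
    proof
      fix i assume i: "i \<in> {1..n}"
      then have "s i \<in> {1..n}" by (simp only: permutes_in_image[OF s])
      then show "w i \<in> colors l \<times> {1..n}"
        using wi[OF i] PiE_mem[OF e, of "s i"] by (simp del: atLeastAtMost_iff)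
    qed (auto simp: w word_of_def)
    ultimately show "w \<in> ?W" by (simp add: colored_words_def)
  qed
  moreover have "card ?W = card ?P"
    using assms by (simp add: card_colored_words finite_colors card_colors card_cperms)
  ultimately show ?thesis
    using card_subset_eq[of ?W "word_of n ` ?P"]
    by (simp add: bij_betw_def card_image finite_colored_words finite_colors)
qed

lemma circ_succs_subset_uncolored_iff:
  "circ_succs n k \<pi> \<subseteq> uncolored ` X \<longleftrightarrow>
    (\<forall>i\<in>{1..n}. i + k \<in> {1..n} \<longrightarrow> act \<pi> (uncolored i) = uncolored (i + k) \<longrightarrow> i + k \<in> X)"
proof -
  have "inj uncolored"
    by (auto simp: uncolored_def inj_on_def)
  then have mem: "uncolored j \<in> uncolored ` X \<longleftrightarrow> j \<in> X" for j
    by (rule inj_image_mem_iff)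
  have "circ_succs n k \<pi> \<subseteq> uncolored ` X \<longleftrightarrow> (\<forall>i\<in>{1..n}. i + k \<in> {1..n} \<longrightarrow>
      act \<pi> (uncolored i) = uncolored (i + k) \<longrightarrow> act \<pi> (uncolored i) \<in> uncolored ` X)"
    unfolding circ_succs_def by blast
  then show ?thesis by (simp add: mem)
qed

lemma circ_succs_subset_iff:
  "circ_succs n k \<pi> \<subseteq> uncolored ` {1..m} \<longleftrightarrow>
    (\<forall>i\<in>{m - k + 1..n - k}. word_of n \<pi> i \<noteq> uncolored (i + k))"
proof -
  have pos: "i \<in> {m - k + 1..n - k} \<longleftrightarrow> i \<in> {1..n} \<and> i + k \<in> {1..n} \<and> i + k \<notin> {1..m}" for i
    by auto
  show ?thesis
    unfolding circ_succs_subset_uncolored_iff pos Ball_def by (auto simp: word_of_def)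
qed

text \<open>An \<open>m\<close>-circular succession \<open>i + m\<close> exceeds \<open>m\<close>, because positions start at 1.\<close>

lemma circ_succs_subset_iff_empty: "circ_succs n m \<pi> \<subseteq> uncolored ` {1..m} \<longleftrightarrow> circ_succs n m \<pi> = {}"
proof -
  have "circ_succs n m \<pi> \<subseteq> uncolored ` {1..m} \<longleftrightarrow> circ_succs n m \<pi> \<subseteq> uncolored ` {}"
    unfolding circ_succs_subset_uncolored_iff by (intro ball_cong) auto
  then show ?thesis by simp
qed

text \<open>
  As \<open>k \<le> m\<close>, every value \<open>v\<close> in \<open>{m+1..n}\<close> comes with a position \<open>v - k \<ge> 1\<close>; this is why there are
  exactly \<open>n - m\<close> constrained positions. For \<open>k > m\<close> there would be fewer whenever \<open>m < n\<close>.
\<close>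

lemma card_circ_succs_subset:
  assumes l: "1 \<le> l" and mn: "m \<le> n" and km: "k \<le> m"
  shows "int (card {\<pi> \<in> cperms l n. circ_succs n k \<pi> \<subseteq> uncolored ` {1..m}}) = euler_table l n m"
proof -
  let ?Q = "{m - k + 1..n - k}"
  let ?q = "\<lambda>i. uncolored (i + k)"
  let ?P = "{\<pi> \<in> cperms l n. circ_succs n k \<pi> \<subseteq> uncolored ` {1..m}}"
  let ?V = "avoiding_words (colors l) {1..n} {1..n} ?Q ?q"
  have bij: "bij_betw (word_of n) (cperms l n) (colored_words (colors l) {1..n} {1..n})"
    using l by (rule bij_betw_word_of)
  have "word_of n ` ?P = ?V"
    unfolding avoiding_words_def circ_succs_subset_iff bij_betw_imp_surj_on[OF bij, symmetric]
    by (rule Compr_image_eq[symmetric])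
  moreover have "inj_on (word_of n) ?P"
    using bij_betw_imp_inj_on[OF bij] Collect_restrict by (rule inj_on_subset)
  ultimately have "int (card ?P) = int (card ?V)"
    by (simp only: card_image[symmetric])
  also have "\<dots> = euler_table (card (colors l)) n (n - card ?Q)"
    using one_in_colors[OF l] km
    by (intro card_avoiding_words) (auto simp: finite_colors uncolored_def inj_on_def)
  also have "\<dots> = euler_table l n m"
    using mn km card_colors[OF l] by simp
  finally show ?thesis .
qed

theorem theorem3:
  fixes l n m :: nat
  assumes "1 \<le> l" and "m \<le> n"
  shows "(\<forall>k\<le>m. euler_table l n m =
            int (card {\<pi> \<in> cperms l n. circ_succs n k \<pi> \<subseteq> uncolored ` {1..m}}))
       \<and> euler_table l n m =
            int (card {\<pi> \<in> cperms l n. fixed_points n \<pi> \<subseteq> uncolored ` {1..m}})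
       \<and> euler_table l n m =
            int (card {\<pi> \<in> cperms l n. circ_succs n m \<pi> = {}})"
  using card_circ_succs_subset[OF assms] card_circ_succs_subset[OF assms, of m]
  by (simp add: fixed_points_def circ_succs_subset_iff_empty del: One_nat_def)

end
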